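(* For every integer $x$, there is a set $S\subseteq\{0,1,\dots,17|x|\}$ with $|S+S|-|S-S|=x$.
   Context: For a finite set $S$ of integers, $S+S=\{s_1+s_2: s_1,s_2\in S\}$ and $S-S=\{s_1-s_2: s_1,s_2\in S\}$ (both empty if $S$ is empty). *)

theory Defs
  imports Main "HOL-Library.Set_Algebras"
begin

text \<open>
  The sumset is the elementwise sum \<open>S + S\<close> of \<open>HOL-Library.Set_Algebras\<close>.  On sets, \<open>S - S\<close>
  denotes the relative complement, so the set of differences needs its own name.
\<close>

definition difference_set :: "int set \<Rightarrow> int set" where
  "difference_set S = {s - t | s t. s \<in> S \<and> t \<in> S}"

end

theory Submission imports Defs begin

text \<open>
  Replace a set \<open>P\<close> by the union \<open>S\<close> of its translates by \<open>0, m, \<dots>, k m\<close>.  Then \<open>S + S\<close> and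
  \<open>S - S\<close> are unions of \<open>2 k + 1\<close> consecutive translates by multiples of \<open>m\<close> of \<open>P + P\<close> and
  \<open>P - P\<close>.  If a finite set \<open>Q\<close> has no gaps within its residue classes modulo \<open>m\<close>, every further
  translate adds one element per residue class met by \<open>Q\<close>.  Hence, if \<open>P + P\<close> meets one residue class
  more (fewer) than \<open>P - P\<close>, the quantity \<open>|S + S| - |S - S|\<close> grows (drops) by 2 whenever \<open>k\<close> grows
  by 1.  Both signs are realised with two starting sets each, one for either parity.
\<close>

text \<open>For finite \<open>Q\<close>, positive \<open>m\<close> and \<open>gap_free m Q\<close>,
  these are the maxima of the residue classes modulo \<open>m\<close> met by \<open>Q\<close>, so
  their number counts those classes.\<close>

definition tops :: "int \<Rightarrow> int set \<Rightarrow> int set" where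
  "tops m Q = {q \<in> Q. q + m \<notin> Q}"

text \<open>Phrased with bounded quantifiers over \<open>Q\<close>, so that it can be evaluated on
  explicit finite sets.\<close>

definition gap_free :: "int \<Rightarrow> int set \<Rightarrow> bool" where
  "gap_free m Q \<longleftrightarrow> (\<forall>t \<in> tops m Q. \<forall>q \<in> Q. m dvd q - t \<longrightarrow> q \<le> t)"

definition translates :: "int \<Rightarrow> nat \<Rightarrow> int set \<Rightarrow> int set" where
  "translates m k Q = {q + m * int j | q j. q \<in> Q \<and> j \<le> k}"

lemma translates_0 [simp]: "translates m 0 Q = Q"
  by (auto simp: translates_def)

text \<open>If \<open>q + m\<close> is still in \<open>Q\<close>, then shifting \<open>q\<close> by
  \<open>k + 1\<close> steps is shifting \<open>q + m\<close> by \<open>k\<close> steps, so only the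
  tops can yield new elements.\<close>

lemma translates_Suc:
  "translates m (Suc k) Q = translates m k Q \<union> (\<lambda>t. t + m * int (Suc k)) ` tops m Q"
    (is "?L = ?R")
proof
  show "?L \<subseteq> ?R"
  proof
    fix x assume "x \<in> ?L"
    then obtain q j where x: "x = q + m * int j" "q \<in> Q" "j \<le> Suc k"
      by (auto simp: translates_def)
    consider "j \<le> k" | "j = Suc k" "q \<in> tops m Q" | "j = Suc k" "q + m \<in> Q"
      using x by (auto simp: tops_def le_Suc_eq)
    then show "x \<in> ?R"
    proof cases
      case 1
      with x show ?thesis by (auto simp: translates_def)
    next
      case 2
      with x show ?thesis by auto
    next
      case 3
      then have "x = (q + m) + m * int k" using x by (simp add: algebra_simps)
      with 3 show ?thesis unfolding translates_def by blast
    qed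
  qed
  show "?R \<subseteq> ?L"
    unfolding translates_def tops_def by (blast intro: le_SucI)
qed

lemma finite_translates: "finite Q \<Longrightarrow> finite (translates m k Q)"
  by (induction k) (auto simp: translates_Suc tops_def)

lemma card_translates:
  assumes "finite Q" "m > 0" "gap_free m Q"
  shows "card (translates m k Q) = card Q + k * card (tops m Q)"
proof (induction k)
  case (Suc k)
  let ?f = "\<lambda>t. t + m * int (Suc k)"
  have "translates m k Q \<inter> ?f ` tops m Q = {}"
  proof (rule ccontr)
    assume "\<not> ?thesis"
    then obtain q j t where q: "q \<in> Q" "j \<le> k" and t: "t \<in> tops m Q"
      and eq: "q + m * int j = t + m * int (Suc k)"
      unfolding translates_def by blast
    have diff: "q - t = m * (int (Suc k) - int j)" using eq by (simp add: algebra_simps)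
    \<comment> \<open>A collision puts \<open>q\<close> in the class of the top \<open>t\<close>, so
      \<open>q\<close> is at most \<open>t\<close>; yet the difference is positive since
      \<open>j < Suc k\<close>.\<close>
    then have "q \<le> t" using assms(3) q t unfolding gap_free_def by (metis dvd_triv_left)
    moreover have "m * (int (Suc k) - int j) > 0"
      using \<open>m > 0\<close> \<open>j \<le> k\<close> by (intro mult_pos_pos) auto
    ultimately show False using diff by linarith
  qed
  moreover have "card (?f ` tops m Q) = card (tops m Q)"
    by (rule card_image) (simp add: inj_on_def)
  ultimately show ?case
    using Suc assms(1) finite_translates[OF assms(1)]
    by (simp add: translates_Suc card_Un_disjoint tops_def)
qed simp

lemma translates_plus_translates:
  "translates m k P + translates m k P = translates m (2 * k) (P + P)" (is "?L = ?R")
proof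
  show "?L \<subseteq> ?R"
  proof
    fix x assume "x \<in> ?L"
    then obtain p i q j where x: "p \<in> P" "q \<in> P" "i \<le> k" "j \<le> k"
      "x = (p + m * int i) + (q + m * int j)"
      by (auto simp: translates_def elim!: set_plus_elim)
    then have "x = (p + q) + m * int (i + j)" "i + j \<le> 2 * k"
      by (simp_all add: algebra_simps)
    then show "x \<in> ?R"
      using x(1,2) unfolding translates_def by (blast intro: set_plus_intro)
  qed
  show "?R \<subseteq> ?L"
  proof
    fix x assume "x \<in> ?R"
    then obtain p q j where x: "p \<in> P" "q \<in> P" "j \<le> 2 * k" "x = (p + q) + m * int j"
      by (auto simp: translates_def elim!: set_plus_elim)
    \<comment> \<open>Greedy splitting of \<open>j\<close> into two indices at most
      \<open>k\<close>; the truncated \<open>j - i\<close> is 0 when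
      \<open>j \<le> k\<close>.\<close>
    define i where "i = min j k"
    have "x = (p + m * int i) + (q + m * int (j - i))"
      using x(4) unfolding i_def by (simp add: algebra_simps of_nat_diff flip: distrib_left)
    moreover have "i \<le> k" "j - i \<le> k" using x(3) by (auto simp: i_def)
    ultimately show "x \<in> ?L"
      using x(1,2) unfolding translates_def by (blast intro: set_plus_intro)
  qed
qed

text \<open>Differences of two indices range over -k, ..., k; the shift by \<open>m * int k\<close>
  makes them the natural numbers up to \<open>2 * k\<close>.\<close>

lemma difference_set_translates:
  "(\<lambda>d. d + m * int k) ` difference_set (translates m k P)
     = translates m (2 * k) (difference_set P)" (is "?L = ?R")
proof
  show "?L \<subseteq> ?R"
  proof
    fix x assume "x \<in> ?L"
    then obtain p i q j where x: "p \<in> P" "q \<in> P" "i \<le> k" "j \<le> k"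
      "x = (p + m * int i) - (q + m * int j) + m * int k"
      by (auto simp: translates_def difference_set_def)
    then have "x = (p - q) + m * int (k + i - j)" "k + i - j \<le> 2 * k"
      by (simp_all add: algebra_simps of_nat_diff)
    then show "x \<in> ?R"
      using x(1,2) unfolding translates_def difference_set_def by blast
  qed
  show "?R \<subseteq> ?L"
  proof
    fix x assume "x \<in> ?R"
    then obtain p q j where x: "p \<in> P" "q \<in> P" "j \<le> 2 * k" "x = (p - q) + m * int j"
      by (auto simp: translates_def difference_set_def)
    define i where "i = min j k"
    have "x = ((p + m * int i) - (q + m * int (k - (j - i)))) + m * int k"
      using x(3,4) unfolding i_def by (cases "j \<le> k") (simp_all add: algebra_simps of_nat_diff)
    moreover have "i \<le> k" "k - (j - i) \<le> k" by (auto simp: i_def)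
    ultimately show "x \<in> ?L"
      using x(1,2) unfolding translates_def difference_set_def by blast
  qed
qed

lemma card_difference_set_translates:
  "card (difference_set (translates m k P)) = card (translates m (2 * k) (difference_set P))"
  unfolding difference_set_translates[symmetric]
  by (rule card_image[symmetric]) (simp add: inj_on_def)

lemma sums_minus_differences_translates:
  assumes "finite P" "m > 0" "gap_free m (P + P)" "gap_free m (difference_set P)"
  shows "int (card (translates m k P + translates m k P))
           - int (card (difference_set (translates m k P)))
         = int (card (P + P)) - int (card (difference_set P))
           + 2 * int k * (int (card (tops m (P + P))) - int (card (tops m (difference_set P))))"
proof -
  have "difference_set P = (\<lambda>(s, t). s - t) ` (P \<times> P)"
    by (auto simp: difference_set_def)
  then have "finite (difference_set P)" using assms(1) by simp
  moreover have "finite (P + P)" using assms(1) by (rule finite_set_plus[OF _ assms(1)])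
  ultimately show ?thesis
    using assms
    by (simp add: translates_plus_translates card_difference_set_translates card_translates
        algebra_simps)
qed

lemma translates_subset:
  assumes "P \<subseteq> {0..w}" "m \<ge> 0" "w + m * int k \<le> b"
  shows "translates m k P \<subseteq> {0..b}"
proof
  fix x assume "x \<in> translates m k P"
  then obtain q j where x: "x = q + m * int j" "q \<in> P" "j \<le> k"
    by (auto simp: translates_def)
  have "m * int j \<le> m * int k" "0 \<le> m * int j"
    using assms(2) x(3) by (simp_all add: mult_left_mono)
  moreover have "0 \<le> q" "q \<le> w" using assms(1) x(2) by auto
  ultimately show "x \<in> {0..b}" using x(1) assms(3) by simp
qed

text \<open>This and the next two equations replace set comprehensions by unions, images and
  filters, which \<open>code_simp\<close> can evaluate.\<close>

lemma sumset_code: "(A :: int set) + B = (\<Union>a\<in>A. (\<lambda>b. a + b) ` B)"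
  by (auto simp: set_plus_def)

lemma difference_set_code: "difference_set A = (\<Union>a\<in>A. (\<lambda>b. a - b) ` A)"
  by (auto simp: difference_set_def)

lemma tops_code: "tops m Q = Set.filter (\<lambda>q. q + m \<notin> Q) Q"
  by (auto simp: tops_def)

lemmas set_codes = gap_free_def tops_code sumset_code difference_set_code

text \<open>Conway's set with more sums than differences. Modulo 12 its sums meet every class, while
  its differences miss exactly the class of 6.\<close>

lemma family_pos_odd:
  fixes P :: "int set" defines "P \<equiv> {0, 2, 3, 4, 7, 11, 12, 14}"
  shows "gap_free 12 (P + P)" "gap_free 12 (difference_set P)"
    "card (P + P) = 26" "card (difference_set P) = 25"
    "card (tops 12 (P + P)) = 12" "card (tops 12 (difference_set P)) = 11"
  unfolding P_def set_codes by code_simp+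

text \<open>The differences again miss only 6 modulo 12, but the starting excess is 2.\<close>

lemma family_pos_even:
  fixes P :: "int set" defines "P \<equiv> {0, 1, 2, 4, 5, 9, 12, 13, 14, 16, 17}"
  shows "gap_free 12 (P + P)" "gap_free 12 (difference_set P)"
    "card (P + P) = 35" "card (difference_set P) = 33"
    "card (tops 12 (P + P)) = 12" "card (tops 12 (difference_set P)) = 11"
  unfolding P_def set_codes by code_simp+

text \<open>A perfect difference set modulo 7: the differences meet every class, the sums miss only
  5.\<close>

lemma family_neg_odd:
  fixes P :: "int set" defines "P \<equiv> {0, 1, 3}"
  shows "gap_free 7 (P + P)" "gap_free 7 (difference_set P)"
    "card (P + P) = 6" "card (difference_set P) = 7"
    "card (tops 7 (P + P)) = 6" "card (tops 7 (difference_set P)) = 7"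
  unfolding P_def set_codes by code_simp+

text \<open>Modulo 8 the differences meet every class and the sums miss only 7; the starting excess
  is -2.\<close>

lemma family_neg_even:
  fixes P :: "int set" defines "P \<equiv> {0, 1, 3, 5}"
  shows "gap_free 8 (P + P)" "gap_free 8 (difference_set P)"
    "card (P + P) = 9" "card (difference_set P) = 11"
    "card (tops 8 (P + P)) = 7" "card (tops 8 (difference_set P)) = 8"
  unfolding P_def set_codes by code_simp+

theorem theorem4:
  fixes x :: int
  shows "\<exists>S :: int set. S \<subseteq> {0..17 * \<bar>x\<bar>} \<and>
           int (card (S + S)) - int (card (difference_set S)) = x"
proof -
  consider "x = 0" | k where "x = 1 + 2 * int k" | k where "x = 2 + 2 * int k"
    | k where "x = - 1 - 2 * int k" | k where "x = - 2 - 2 * int k"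
  proof (cases "x = 0")
    case False
    \<comment> \<open>Chosen so that \<bar>x\<bar> is \<open>2 * n + 1\<close> or
      \<open>2 * n + 2\<close>.\<close>
    define n where "n = nat ((\<bar>x\<bar> - 1) div 2)"
    have "int n = (\<bar>x\<bar> - 1) div 2" using False by (simp add: n_def)
    then have "x = 1 + 2 * int n \<or> x = 2 + 2 * int n \<or> x = - 1 - 2 * int n \<or> x = - 2 - 2 * int n"
      using False by presburger
    then show ?thesis using that by blast
  qed (use that in blast)
  then show ?thesis
  proof cases
    case 1
    then show ?thesis by (intro exI[of _ "{}"]) (simp add: set_plus_def difference_set_def)
  next
    \<comment> \<open>In each remaining case the largest element is the width of the starting set
      plus \<open>m * k\<close>; here 14 + 12k, which is at most 17(1 + 2k).\<close>
    case (2 k)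
    then show ?thesis
      using sums_minus_differences_translates[OF _ _ family_pos_odd(1,2), of k]
      by (intro exI[of _ "translates 12 k {0, 2, 3, 4, 7, 11, 12, 14}"] conjI
          translates_subset[of _ 14]) (simp_all add: family_pos_odd(3-6))
  next
    case (3 k)
    then show ?thesis
      using sums_minus_differences_translates[OF _ _ family_pos_even(1,2), of k]
      by (intro exI[of _ "translates 12 k {0, 1, 2, 4, 5, 9, 12, 13, 14, 16, 17}"] conjI
          translates_subset[of _ 17]) (simp_all add: family_pos_even(3-6))
  next
    case (4 k)
    then show ?thesis
      using sums_minus_differences_translates[OF _ _ family_neg_odd(1,2), of k]
      by (intro exI[of _ "translates 7 k {0, 1, 3}"] conjI
          translates_subset[of _ 3]) (simp_all add: family_neg_odd(3-6))
  next
    case (5 k)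
    then show ?thesis
      using sums_minus_differences_translates[OF _ _ family_neg_even(1,2), of k]
      by (intro exI[of _ "translates 8 k {0, 1, 3, 5}"] conjI
          translates_subset[of _ 5]) (simp_all add: family_neg_even(3-6))
  qed
qed

end
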